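(* Let $T>0$ and let $n\ge 1$ be an integer. Let $x_n:\mathbb{R}\to\mathbb{R}$ be a periodic solution of the non-delayed Duffing ordinary differential equation $$\ddot{x}(t)+(-1)^n x(t)+x(t)^3=0$$ with strictly positive energy $$H=\tfrac12\dot{x}_n^2+\tfrac12(-1)^n x_n^2+\tfrac14 x_n^4>0$$ and with minimal period $p_n=2T/n$. Then $x_n(t-T)=(-1)^n x_n(t)$ for all $t\in\mathbb{R}$, and $x_n$ is a periodic solution of the delayed Duffing equation $$\ddot{x}(t)+x(t-T)+x(t)^3=0,\qquad t\in\mathbb{R}.$$
   Context: The energy $H$ is constant along solutions of the ordinary differential equation. The minimal period of a nonconstant periodic function is its smallest positive period. *)

theory Defs
  imports "HOL-Analysis.Analysis" "HOL-Library.Periodic_Fun"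
begin

definition periodic :: "(real \<Rightarrow> real) \<Rightarrow> bool" where
  "periodic x \<longleftrightarrow> (\<exists>p>0. periodic_fun_simple x p)"

(* A constant function has no minimal period in this sense. *)
definition minimal_period :: "(real \<Rightarrow> real) \<Rightarrow> real \<Rightarrow> bool" where
  "minimal_period x p \<longleftrightarrow>
     0 < p \<and> periodic_fun_simple x p \<and> (\<forall>q. 0 < q \<and> periodic_fun_simple x q \<longrightarrow> p \<le> q)"

(* deriv is total, so the existence of both derivatives has to be required separately. *)
definition twice_differentiable :: "(real \<Rightarrow> real) \<Rightarrow> bool" where
  "twice_differentiable x \<longleftrightarrow>
     (\<forall>t. x differentiable (at t)) \<and> (\<forall>t. deriv x differentiable (at t))"

definition duffing_ode_solution :: "nat \<Rightarrow> (real \<Rightarrow> real) \<Rightarrow> bool" where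
  "duffing_ode_solution n x \<longleftrightarrow>
     twice_differentiable x \<and>
     (\<forall>t. deriv (deriv x) t + (-1) ^ n * x t + x t ^ 3 = 0)"

definition duffing_energy :: "nat \<Rightarrow> (real \<Rightarrow> real) \<Rightarrow> real \<Rightarrow> real" where
  "duffing_energy n x t =
     1 / 2 * (deriv x t)\<^sup>2 + 1 / 2 * (-1) ^ n * (x t)\<^sup>2 + 1 / 4 * x t ^ 4"

definition delayed_duffing_solution :: "real \<Rightarrow> (real \<Rightarrow> real) \<Rightarrow> bool" where
  "delayed_duffing_solution T x \<longleftrightarrow>
     twice_differentiable x \<and>
     (\<forall>t. deriv (deriv x) t + x (t - T) + x t ^ 3 = 0)"

end

theory Submission
  imports Defs
begin

text \<open>
  Only odd \<open>n\<close> needs an argument: then \<open>p/2\<close> must be an antiperiod, where \<open>p\<close> is the minimal period.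
  At a maximum point \<open>a\<close> and at a minimum point \<open>b\<close> the velocity vanishes, and for \<open>H > 0\<close> the
  equation \<open>u\<^sup>2 / 4 - u / 2 = H\<close> has only one solution \<open>u \<ge> 0\<close>; hence \<open>x(b) = - x(a)\<close>. As the
  equation is odd and autonomous, uniqueness for the initial value problem gives
  \<open>x(t + c) = - x(t)\<close> with \<open>c = b - a\<close>. Now \<open>2c\<close> is a multiple of \<open>p\<close>, and an odd one because
  \<open>x \<noteq> 0\<close>, so \<open>p/2\<close> is an antiperiod as well.
\<close>

lemma periodic_fun_simple_plus_int:
  fixes f :: "real \<Rightarrow> 'a"
  assumes "periodic_fun_simple f p"
  shows "f (t + of_int k * p) = f t"
proof -
  interpret periodic_fun_simple f p by fact
  show ?thesis by (rule plus_of_int)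
qed

text \<open>The remainder of \<open>q\<close> modulo \<open>p\<close> is again a period and lies in
  [0, p), so minimality forces it to be 0. The sign of \<open>q\<close> does not matter.\<close>

lemma minimal_period_dvd:
  assumes "minimal_period f p" and per: "\<And>t. f (t + q) = f t"
  obtains k :: int where "q = of_int k * p"
proof -
  have p: "0 < p" "periodic_fun_simple f p"
    and min: "\<And>r. 0 < r \<Longrightarrow> periodic_fun_simple f r \<Longrightarrow> p \<le> r"
    using assms(1) by (auto simp: minimal_period_def)
  define k where "k = \<lfloor>q / p\<rfloor>"
  define r where "r = q - of_int k * p"
  have "of_int k \<le> q / p" "q / p < of_int k + 1"
    unfolding k_def by linarith+
  then have r: "0 \<le> r" "r < p"
    using p(1) by (simp_all add: r_def field_simps)
  have "f (t + r) = f t" for t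
  proof -
    have "f (t + r) = f (t + r + of_int k * p)"
      by (rule periodic_fun_simple_plus_int[OF p(2), symmetric])
    also have "\<dots> = f t" using per[of t] by (simp add: r_def)
    finally show ?thesis .
  qed
  then have "periodic_fun_simple f r" by unfold_locales
  with r min[of r] have "r = 0" by linarith
  then show thesis using that[of k] by (simp add: r_def)
qed

text \<open>Compactness of one closed period yields the extrema there; translation by whole periods
  carries every value into it.\<close>

lemma periodic_continuous_attains_bounds:
  fixes f :: "real \<Rightarrow> real"
  assumes p: "0 < p" "periodic_fun_simple f p" and cont: "continuous_on UNIV f"
  obtains a b where "\<And>t. f t \<le> f a" and "\<And>t. f b \<le> f t"
proof -
  have cont': "continuous_on {0..p} f" using cont continuous_on_subset by blast
  have ne: "{0..p} \<noteq> {}" using p by simp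
  obtain a where a: "\<And>t. t \<in> {0..p} \<Longrightarrow> f t \<le> f a"
    using continuous_attains_sup[OF compact_Icc ne cont'] by blast
  obtain b where b: "\<And>t. t \<in> {0..p} \<Longrightarrow> f b \<le> f t"
    using continuous_attains_inf[OF compact_Icc ne cont'] by blast
  have red: "\<exists>u\<in>{0..p}. f u = f t" for t
  proof -
    define k where "k = - \<lfloor>t / p\<rfloor>"
    have "of_int (- k) \<le> t / p" "t / p < of_int (- k) + 1" unfolding k_def by linarith+
    then have "t + of_int k * p \<in> {0..p}" using p(1) by (simp add: field_simps)
    then show ?thesis using periodic_fun_simple_plus_int[OF p(2)] by blast
  qed
  show thesis
    by (rule that[of a b]) (metis red a, metis red b)
qed

text \<open>Gronwall in both time directions: \<open>E t * exp (- K * t)\<close> is nonincreasing,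
  which spreads the zero at \<open>a\<close> forwards, and \<open>E t * exp (K * t)\<close> is
  nondecreasing, which spreads it backwards.\<close>

lemma gronwall_zero:
  fixes E :: "real \<Rightarrow> real"
  assumes der: "\<And>t. (E has_real_derivative E' t) (at t)"
    and bound: "\<And>t. \<bar>E' t\<bar> \<le> K * E t" and nonneg: "\<And>t. 0 \<le> E t" and "E a = 0"
  shows "E t = 0"
proof (cases "a \<le> t")
  case True
  have "E t * exp (- K * t) \<le> E a * exp (- K * a)"
  proof (rule DERIV_nonpos_imp_nonincreasing[OF True], intro exI conjI)
    fix u
    show "((\<lambda>t. E t * exp (- K * t)) has_real_derivative (E' u - K * E u) * exp (- K * u)) (at u)"
      by (auto intro!: derivative_eq_intros der simp: algebra_simps)
    show "(E' u - K * E u) * exp (- K * u) \<le> 0"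
      using bound[of u] by (intro mult_nonpos_nonneg) auto
  qed
  then show ?thesis
    using nonneg[of t] \<open>E a = 0\<close> by (simp add: mult_le_0_iff)
next
  case False
  then have "t \<le> a" by simp
  have "E t * exp (K * t) \<le> E a * exp (K * a)"
  proof (rule DERIV_nonneg_imp_nondecreasing[OF \<open>t \<le> a\<close>], intro exI conjI)
    fix u
    show "((\<lambda>t. E t * exp (K * t)) has_real_derivative (E' u + K * E u) * exp (K * u)) (at u)"
      by (auto intro!: derivative_eq_intros der simp: algebra_simps)
    show "(E' u + K * E u) * exp (K * u) \<ge> 0"
      using bound[of u] by (intro mult_nonneg_nonneg) auto
  qed
  then show ?thesis
    using nonneg[of t] \<open>E a = 0\<close> by (simp add: mult_le_0_iff)
qed

text \<open>The cubic is Lipschitz only on bounded sets, hence the common bound \<open>M\<close>.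
  Gronwall is applied to the squared distance in the phase plane.\<close>

lemma duffing_unique:
  fixes x y v w :: "real \<Rightarrow> real"
  assumes x: "\<And>t. (x has_real_derivative v t) (at t)"
    and v: "\<And>t. (v has_real_derivative - s * x t - x t ^ 3) (at t)"
    and y: "\<And>t. (y has_real_derivative w t) (at t)"
    and w: "\<And>t. (w has_real_derivative - s * y t - y t ^ 3) (at t)"
    and bx: "\<And>t. \<bar>x t\<bar> \<le> M" and bY: "\<And>t. \<bar>y t\<bar> \<le> M"
    and init: "x a = y a" "v a = w a"
  shows "x t = y t"
proof -
  \<comment> \<open>Factoring \<open>x - y\<close> out of the difference of the cubes gives v' - w'
    = -(x - y) g. The three quadratic terms of \<open>g\<close> account for
    \<open>3 * M\<^sup>2\<close> in \<open>L\<close>.\<close>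
  define g where "g t = s + (x t)\<^sup>2 + x t * y t + (y t)\<^sup>2" for t
  define L where "L = \<bar>s\<bar> + 3 * M\<^sup>2"
  define E where "E t = (x t - y t)\<^sup>2 + (v t - w t)\<^sup>2" for t
  define E' where "E' t = 2 * ((x t - y t) * (v t - w t)) * (1 - g t)" for t
  have g: "\<bar>g t\<bar> \<le> L" for t
  proof -
    have "(x t)\<^sup>2 \<le> M\<^sup>2" "(y t)\<^sup>2 \<le> M\<^sup>2"
      using bx[of t] bY[of t] by (auto simp: abs_le_square_iff[symmetric])
    moreover have "\<bar>x t * y t\<bar> \<le> M\<^sup>2"
      using mult_mono[OF bx[of t] bY[of t]] bx[of t] by (simp add: abs_mult power2_eq_square)
    moreover have "0 \<le> (x t)\<^sup>2" "0 \<le> (y t)\<^sup>2" by simp_all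
    ultimately show ?thesis unfolding g_def L_def by linarith
  qed
  have "E t = 0"
  proof (rule gronwall_zero[where E = E and E' = E' and K = "1 + L" and a = a])
    fix t
    show "(E has_real_derivative E' t) (at t)"
      unfolding E_def E'_def g_def
      by (rule derivative_eq_intros x y v w refl)+
        (simp add: algebra_simps power2_eq_square power3_eq_cube)
    \<comment> \<open>This is 2|ab| \<le> a^2 + b^2, read off from the squares of a + b and a -
      b.\<close>
    have "\<bar>2 * ((x t - y t) * (v t - w t))\<bar> \<le> E t"
      using zero_le_power2[of "(x t - y t) + (v t - w t)"]
        zero_le_power2[of "(x t - y t) - (v t - w t)"]
      unfolding E_def power2_sum[of "x t - y t" "v t - w t"] power2_diff[of "x t - y t" "v t - w t"]
      by linarith
    moreover have "\<bar>1 - g t\<bar> \<le> 1 + L" using g[of t] by linarith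
    ultimately have "\<bar>2 * ((x t - y t) * (v t - w t))\<bar> * \<bar>1 - g t\<bar> \<le> E t * (1 + L)"
      by (intro mult_mono) (auto simp: E_def)
    then show "\<bar>E' t\<bar> \<le> (1 + L) * E t" by (simp add: E'_def abs_mult mult.commute)
  qed (auto simp: E_def init)
  then show ?thesis by (simp add: E_def add_nonneg_eq_0_iff)
qed

text \<open>The derivative of \<open>H\<close> is v (v' + s x + x^3), which the equation makes
  0.\<close>

lemma duffing_energy_constant:
  fixes x v :: "real \<Rightarrow> real"
  assumes x: "\<And>t. (x has_real_derivative v t) (at t)"
    and v: "\<And>t. (v has_real_derivative - s * x t - x t ^ 3) (at t)"
  defines "H \<equiv> \<lambda>t. 1 / 2 * (v t)\<^sup>2 + 1 / 2 * s * (x t)\<^sup>2 + 1 / 4 * x t ^ 4"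
  shows "H t = H u"
proof (rule DERIV_isconst_all[where f = H], intro allI)
  fix t
  show "(H has_real_derivative 0) (at t)"
    unfolding H_def
    by (rule derivative_eq_intros x v refl)+
      (simp add: algebra_simps power2_eq_square power3_eq_cube)
qed

lemma duffing_antiperiod:
  fixes x v :: "real \<Rightarrow> real"
  assumes x: "\<And>t. (x has_real_derivative v t) (at t)"
    and v: "\<And>t. (v has_real_derivative - s * x t - x t ^ 3) (at t)"
    and energy: "\<And>t. 0 < 1 / 2 * (v t)\<^sup>2 + 1 / 2 * s * (x t)\<^sup>2 + 1 / 4 * x t ^ 4"
    and p: "minimal_period x p"
  shows "x (t + p / 2) = - x t"
proof -
  have p0: "0 < p" "periodic_fun_simple x p" using p by (auto simp: minimal_period_def)
  have "continuous_on UNIV x"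
    by (meson DERIV_isCont continuous_at_imp_continuous_on x)
  then obtain a b where a: "\<And>t. x t \<le> x a" and b: "\<And>t. x b \<le> x t"
    using periodic_continuous_attains_bounds[OF p0] by metis
  have va: "v a = 0" by (rule DERIV_local_max[OF x zero_less_one]) (simp add: a)
  have vb: "v b = 0" by (rule DERIV_local_min[OF x zero_less_one]) (simp add: b)
  \<comment> \<open>Equal extremes would make \<open>x\<close> constant, and then
    \<open>p / 2\<close> would be a period below the minimal one.\<close>
  have "x b \<noteq> x a"
  proof
    assume "x b = x a"
    then have "x t = x a" for t using a[of t] b[of t] by simp
    then have "periodic_fun_simple x (p / 2)" by unfold_locales metis
    then have "p \<le> p / 2" using p half_gt_zero[OF p0(1)] unfolding minimal_period_def by blast
    then show False using p0(1) by simp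
  qed
  moreover have "(x a)\<^sup>2 = (x b)\<^sup>2"
  proof -
    \<comment> \<open>Where the velocity vanishes, 4H = 2sA + A^2, and likewise for B. Equating the
      two and factoring leaves A = B or A + B + 2s = 0; the latter would give 4H = -AB \<le>
      0.\<close>
    define A B where "A = (x a)\<^sup>2" and "B = (x b)\<^sup>2"
    have nonneg: "0 \<le> A" "0 \<le> B" by (simp_all add: A_def B_def)
    have pos: "0 < 2 * s * A + A * A"
      using energy[of a] by (simp add: va A_def power2_eq_square power4_eq_xxxx algebra_simps)
    have "2 * s * A + A * A = 2 * s * B + B * B"
      using duffing_energy_constant[OF x v, of a b]
      by (simp add: va vb A_def B_def power2_eq_square power4_eq_xxxx algebra_simps)
    then have "(A - B) * (A + B + 2 * s) = 0" by (simp add: algebra_simps)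
    moreover have "A + B + 2 * s \<noteq> 0"
    proof
      assume "A + B + 2 * s = 0"
      then have "2 * s * A + A * A = - (A * B)" by algebra
      then show False using pos mult_nonneg_nonneg[OF nonneg] by linarith
    qed
    ultimately show ?thesis by (simp add: A_def B_def)
  qed
  ultimately have ba: "x b = - x a" by (metis power2_eq_iff)
  define c where "c = b - a"
  have shift: "x (t + c) = - x t" for t
  proof -
    \<comment> \<open>At time \<open>a\<close> both sides have value \<open>x a\<close> and velocity
      0. Since \<open>x b = - x a\<close>, all values lie between \<open>- x a\<close> and
      \<open>x a\<close>, so \<open>M = x a\<close> bounds both.\<close>
    have "x t = - x (t + c)"
    proof (rule duffing_unique[where v = v and w = "\<lambda>t. - v (t + c)" and s = s and M = "x a"
          and a = a, OF x v])
      fix t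
      show "((\<lambda>t. - x (t + c)) has_real_derivative - v (t + c)) (at t)"
        using x[of "t + c"] by (intro DERIV_minus) (simp add: DERIV_shift)
      have "((\<lambda>t. - v (t + c)) has_real_derivative - (- s * x (t + c) - x (t + c) ^ 3)) (at t)"
        using v[of "t + c"] by (intro DERIV_minus) (simp add: DERIV_shift)
      then show "((\<lambda>t. - v (t + c)) has_real_derivative
          - s * - x (t + c) - (- x (t + c)) ^ 3) (at t)"
        by (simp add: add.commute)
      show "\<bar>x t\<bar> \<le> x a" using a[of t] b[of t] ba by simp
      show "\<bar>- x (t + c)\<bar> \<le> x a" using a[of "t + c"] b[of "t + c"] ba by simp
    qed (simp_all add: c_def ba va vb)
    then show ?thesis by simp
  qed
  have "x (t + 2 * c) = x t" for t
    using shift[of t] shift[of "t + c"] by (simp add: add.assoc)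
  then obtain k where k: "2 * c = of_int k * p" by (rule minimal_period_dvd[OF p])
  \<comment> \<open>For even \<open>k\<close> the shift \<open>c\<close> would be a whole number of
    periods, so \<open>x a\<close> would equal \<open>- x a\<close>, that is,
    \<open>x b\<close>.\<close>
  have "odd k"
  proof
    assume "even k"
    then obtain j where "k = 2 * j" by blast
    then have "c = of_int j * p" using k by simp
    then have "x (a + c) = x a" using periodic_fun_simple_plus_int[OF p0(2)] by simp
    then show False using shift[of a] ba \<open>x b \<noteq> x a\<close> by simp
  qed
  then obtain j where "k = 2 * j + 1" by (rule oddE)
  then have "c = p / 2 + of_int j * p" using k by (simp add: algebra_simps)
  then have "x (t + p / 2) = x (t + c)"
    using periodic_fun_simple_plus_int[OF p0(2), of "t + p / 2" j] by (simp add: add.assoc)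
  then show ?thesis by (simp add: shift)
qed

theorem mainTheorem1:
  fixes T :: real and n :: nat and x :: "real \<Rightarrow> real"
  assumes "T > 0" and "n \<ge> 1"
    and "duffing_ode_solution n x" and "periodic x"
    and "\<And>t. duffing_energy n x t > 0"
    and "minimal_period x (2 * T / real n)"
  shows "(\<forall>t. x (t - T) = (-1) ^ n * x t) \<and> delayed_duffing_solution T x \<and> periodic x"
proof -
  define p where "p = 2 * T / real n"
  have p: "minimal_period x p" using assms(6) by (simp add: p_def)
  then have per: "periodic_fun_simple x p" by (simp add: minimal_period_def)
  have np: "real n * p = 2 * T" using assms(2) by (simp add: p_def)
  have twice: "twice_differentiable x"
    and ode: "\<And>t. deriv (deriv x) t + (-1) ^ n * x t + x t ^ 3 = 0"
    using assms(3) by (auto simp: duffing_ode_solution_def)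
  have x: "(x has_real_derivative deriv x t) (at t)" for t
    using twice by (simp add: twice_differentiable_def DERIV_deriv_iff_real_differentiable)
  \<comment> \<open>The equation is solved for the second derivative in the shape used above, with
    \<open>s = (-1) ^ n\<close>.\<close>
  have v: "(deriv x has_real_derivative - ((-1) ^ n) * x t - x t ^ 3) (at t)" for t
  proof -
    have "(deriv x has_real_derivative deriv (deriv x) t) (at t)"
      using twice by (simp add: twice_differentiable_def DERIV_deriv_iff_real_differentiable)
    moreover have "deriv (deriv x) t = - ((-1) ^ n) * x t - x t ^ 3" using ode[of t] by simp
    ultimately show ?thesis by simp
  qed
  have energy: "0 < 1 / 2 * (deriv x t)\<^sup>2 + 1 / 2 * (-1) ^ n * (x t)\<^sup>2 + 1 / 4 * x t ^ 4" for t
    using assms(5)[of t] by (simp add: duffing_energy_def)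
  have delay: "x (t - T) = (-1) ^ n * x t" for t
  proof (cases "even n")
    case True
    \<comment> \<open>For even \<open>n\<close> the delay is \<open>m\<close> whole periods.\<close>
    then obtain m where "n = 2 * m" by blast
    then have "T = of_int (int m) * p" using np by simp
    then show ?thesis
      using periodic_fun_simple_plus_int[OF per, of "t - T" "int m"] True by simp
  next
    case False
    then obtain m where m: "n = 2 * m + 1" by (rule oddE)
    \<comment> \<open>For odd \<open>n\<close> the delay is half a period plus \<open>m\<close>
      whole ones, so exactly one sign change remains.\<close>
    then have T: "T = p / 2 + of_int (int m) * p" using np by (simp add: algebra_simps)
    have "- x (t - T) = x (t - T + p / 2)"
      by (rule duffing_antiperiod[OF x v energy p, symmetric])
    also have "\<dots> = x (t - T + p / 2 + of_int (int m) * p)"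
      by (rule periodic_fun_simple_plus_int[OF per, symmetric])
    also have "\<dots> = x t" by (simp add: T)
    finally show ?thesis using False by simp
  qed
  \<comment> \<open>Replacing the delayed term by \<open>(-1) ^ n * x t\<close> turns the delayed
    equation into the ordinary one.\<close>
  moreover have "delayed_duffing_solution T x"
    using twice ode by (simp add: delayed_duffing_solution_def delay)
  ultimately show ?thesis using assms(4) by blast
qed

end
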